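(* Let $d\ge k\ge3$ and $j\ge1$ be integers with $(2^k-1)j+2\ge\max\{dk,\,dk+4-k\}$. Then there exists a $\mathfrak W_k$-equivariant map $Z_{d,k}\to S(U_k^{\oplus j})$.
   Context: $Z_{d,k}=\{(x_1,\dots,x_k)\in(S^d)^k: x_r\ne\pm x_s\text{ for } r<s\}$, with $\mathfrak W_k=(\mathbb{Z}/2)^k\rtimes\mathfrak S_k$ acting (freely) by $((\beta_1,\dots,\beta_k)\rtimes\tau)\cdot(v_1,\dots,v_k)=((-1)^{\beta_1}v_{\tau^{-1}(1)},\dots,(-1)^{\beta_k}v_{\tau^{-1}(k)})$. $U_k=\{(y_\alpha)_{\alpha\in(\mathbb{Z}/2)^k}:\sum_\alpha y_\alpha=0\}\subset\mathbb{R}^{(\mathbb{Z}/2)^k}$ with $\mathfrak W_k$ permuting coordinates via the index action $((\beta)\rtimes\tau)\cdot\alpha=(\beta_1+\alpha_{\tau^{-1}(1)},\dots,\beta_k+\alpha_{\tau^{-1}(k)})$ mod 2; $U_k^{\oplus j}$ has the diagonal action and $S(\cdot)$ is the unit sphere. *)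

theory Defs
  imports "HOL-Analysis.Analysis" "HOL-Combinatorics.Permutations"
begin

text \<open>Points of S^d are functions nat => real supported in {0..d} with unit
  Euclidean norm. A k-tuple of such points is a function nat => (nat => real),
  indexed by r < k and zero for r >= k. Topologies are the (product) topologies
  on function spaces, which restrict to the Euclidean ones on these carriers.\<close>

definition sphere_pt :: "nat \<Rightarrow> (nat \<Rightarrow> real) \<Rightarrow> bool" where
  "sphere_pt d x \<longleftrightarrow> (\<forall>i>d. x i = 0) \<and> (\<Sum>i\<le>d. (x i)^2) = 1"

definition Zdk :: "nat \<Rightarrow> nat \<Rightarrow> (nat \<Rightarrow> nat \<Rightarrow> real) set" where
  "Zdk d k = {X. (\<forall>r<k. sphere_pt d (X r)) \<and> (\<forall>r\<ge>k. X r = (\<lambda>_. 0)) \<and>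
      (\<forall>r s. r < s \<and> s < k \<longrightarrow> X r \<noteq> X s \<and> X r \<noteq> (\<lambda>i. - X s i))}"

text \<open>Elements alpha of (Z/2)^k are encoded as subsets of {..<k} (alpha_i = 1 iff i in alpha).
  A point of U_k^{\<oplus>j} is Y :: nat => nat set => real, with Y l alpha the alpha-coordinate
  of the l-th summand (l < j), zero outside l < j, alpha \<subseteq> {..<k}.\<close>

definition SU :: "nat \<Rightarrow> nat \<Rightarrow> (nat \<Rightarrow> nat set \<Rightarrow> real) set" where
  "SU k j = {Y. (\<forall>l \<alpha>. \<not> (l < j \<and> \<alpha> \<subseteq> {..<k}) \<longrightarrow> Y l \<alpha> = 0) \<and>
      (\<forall>l<j. (\<Sum>\<alpha>\<in>Pow {..<k}. Y l \<alpha>) = 0) \<and>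
      (\<Sum>l<j. \<Sum>\<alpha>\<in>Pow {..<k}. (Y l \<alpha>)^2) = 1}"

definition actZ :: "nat set \<Rightarrow> (nat \<Rightarrow> nat) \<Rightarrow> (nat \<Rightarrow> nat \<Rightarrow> real) \<Rightarrow> (nat \<Rightarrow> nat \<Rightarrow> real)" where
  "actZ \<beta> \<tau> X = (\<lambda>i v. (if i \<in> \<beta> then -1 else 1) * X (inv \<tau> i) v)"

text \<open>Index action on (Z/2)^k: g.alpha = beta symmetric-difference (tau ` alpha);
  hence g^{-1}.alpha = inv tau ` (beta symmetric-difference alpha).\<close>
text \<open>Permutation of coordinates: (g.y)_{g.alpha} = y_alpha, i.e. (g.y)_alpha = y_{g^{-1}.alpha}.\<close>
definition actU :: "nat set \<Rightarrow> (nat \<Rightarrow> nat) \<Rightarrow> (nat \<Rightarrow> nat set \<Rightarrow> real) \<Rightarrow> (nat \<Rightarrow> nat set \<Rightarrow> real)" where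
  "actU \<beta> \<tau> Y = (\<lambda>l \<alpha>. Y l (inv \<tau> ` ((\<beta> - \<alpha>) \<union> (\<alpha> - \<beta>))))"

end

theory Submission
  imports Defs
begin

text \<open>Dividing each point of a configuration by its first nonzero coordinate gives its affine form.
  For every m count the distinct truncations to the coordinates 0, ..., m of the affine forms of
  those points that have a nonzero coordinate before position m. The sum of these counts over
  m = 1, ..., d is invariant under the group and takes values between k - 1 and d k, that is, at most
  d k - k + 2 values. On the set where it equals a given value q, being canonical (positive first
  nonzero coordinates, affine forms in lexicographic order) is an open condition, and every
  orbit contains exactly one canonical configuration. This yields continuous bump functions
  b(q, g) = b(q) o g, such that for each q at most one b(q, g) is nonzero at a given point, and at
  every point some b(q, g) is nonzero. Choose vectors v(q) on a moment curve in the j-fold sum of U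
  such that arbitrary translates of them by group elements, one for each q, are linearly
  independent; the dimension (2^k - 1) j allows d k - k + 2 of them. Then the sum of the
  b(q, g) g^(-1) v(q) is equivariant and vanishes nowhere, so it can be normalised.\<close>

subsection \<open>Vectors in general position\<close>

text \<open>Gaussian elimination: an equation involving the unknown \<open>p\<close> determines
  \<open>a p\<close> from the other unknowns, and substituting it leaves one equation and one
  unknown fewer.\<close>

lemma underdetermined_system_solution:
  fixes w :: "nat \<Rightarrow> 'i \<Rightarrow> real"
  assumes "finite I" "m < card I"
  shows "\<exists>a. (\<exists>x\<in>I. a x \<noteq> 0) \<and> (\<forall>i<m. (\<Sum>x\<in>I. a x * w i x) = 0)"
  using assms
proof (induction m arbitrary: I w)
  case 0
  then obtain x where "x \<in> I" by fastforce
  then show ?case by (intro exI[of _ "\<lambda>_. 1"]) auto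
next
  case (Suc m)
  show ?case
  proof (cases "\<exists>p\<in>I. w m p \<noteq> 0")
    case False
    obtain a where "\<exists>x\<in>I. a x \<noteq> 0" "\<forall>i<m. (\<Sum>x\<in>I. a x * w i x) = 0"
      using Suc.IH[of I w] Suc.prems by auto
    with False show ?thesis
      by (intro exI[of _ a]) (auto simp: less_Suc_eq)
  next
    case True
    then obtain p where p: "p \<in> I" "w m p \<noteq> 0" by blast
    define J where "J = I - {p}"
    have J: "finite J" "m < card J" "p \<notin> J" "I = insert p J"
      using Suc.prems p by (auto simp: J_def)
    obtain a where a: "\<exists>x\<in>J. a x \<noteq> 0"
      "\<forall>i<m. (\<Sum>x\<in>J. a x * (w i x - w m x / w m p * w i p)) = 0"
      using Suc.IH[OF J(1,2), of "\<lambda>i x. w i x - w m x / w m p * w i p"] by blast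
    define b where "b = a(p := - (\<Sum>x\<in>J. a x * w m x) / w m p)"
    have b: "(\<Sum>x\<in>I. b x * w i x) = (\<Sum>x\<in>J. a x * (w i x - w m x / w m p * w i p))" for i
    proof -
      have "(\<Sum>x\<in>J. b x * w i x) = (\<Sum>x\<in>J. a x * w i x)"
        using J(3) by (intro sum.cong) (auto simp: b_def)
      then have "(\<Sum>x\<in>I. b x * w i x)
          = - (\<Sum>x\<in>J. a x * w m x) / w m p * w i p + (\<Sum>x\<in>J. a x * w i x)"
        using J by (simp add: b_def)
      also have "\<dots> = (\<Sum>x\<in>J. a x * (w i x - w m x / w m p * w i p))"
        by (simp add: algebra_simps sum_subtractf sum_distrib_left sum_divide_distrib)
      finally show ?thesis .
    qed
    have "(\<Sum>x\<in>I. b x * w m x) = 0"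
      unfolding b using p by (intro sum.neutral) auto
    moreover have "\<exists>x\<in>I. b x \<noteq> 0"
      using a(1) J(3,4) by (auto simp: b_def)
    ultimately show ?thesis
      using a(2) b by (intro exI[of _ b]) (auto simp: less_Suc_eq)
  qed
qed

text \<open>Distinct exponents keep the monomials from cancelling, so the sum is a nonzero
  polynomial in \<open>t\<close>.\<close>

lemma finite_zeros_exponential_sum:
  fixes a :: "'i \<Rightarrow> real"
  assumes "finite I" "inj_on e I" "x \<in> I" "a x \<noteq> 0"
  shows "finite {t. (\<Sum>x\<in>I. a x * t ^ e x) = 0}"
proof -
  define p where "p = (\<Sum>x\<in>I. monom (a x) (e x))"
  have "coeff p (e x) = (\<Sum>y\<in>I. if x = y then a x else 0)"
    unfolding p_def coeff_sum coeff_monom using assms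
    by (intro sum.cong) (auto dest: inj_onD)
  then have "p \<noteq> 0" using assms by auto
  moreover have "poly p t = (\<Sum>x\<in>I. a x * t ^ e x)" for t
    by (simp add: p_def poly_sum poly_monom)
  ultimately show ?thesis using poly_roots_finite[of p] by simp
qed

text \<open>Each new parameter has to avoid the zeros of finitely many functionals, one for every choice
  of translates of the vectors found before.\<close>

lemma translates_in_general_position:
  fixes w :: "'g \<Rightarrow> real \<Rightarrow> 'i \<Rightarrow> real" and M :: nat
  assumes "finite G"
    and fin: "\<And>a g. a \<in> A \<Longrightarrow> g \<in> G \<Longrightarrow> finite {t. (\<Sum>x\<in>I. a x * w g t x) = 0}"
    and ann: "\<And>n W. n < M \<Longrightarrow> \<exists>a\<in>A. \<forall>i<n. (\<Sum>x\<in>I. a x * W i x) = 0"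
  shows "\<exists>T. \<forall>\<gamma> c. (\<forall>i<M. \<gamma> i \<in> G) \<longrightarrow> (\<forall>x\<in>I. (\<Sum>i<M. c i * w (\<gamma> i) (T i) x) = 0)
           \<longrightarrow> (\<forall>i<M. c i = (0::real))"
proof -
  have "\<exists>T. \<forall>\<gamma> c. (\<forall>i<n. \<gamma> i \<in> G) \<longrightarrow> (\<forall>x\<in>I. (\<Sum>i<n. c i * w (\<gamma> i) (T i) x) = 0)
           \<longrightarrow> (\<forall>i<n. c i = 0)" if "n \<le> M" for n
    using that
  proof (induction n)
    case 0
    show ?case by simp
  next
    case (Suc n)
    then obtain T where T: "\<And>\<gamma> c. (\<forall>i<n. \<gamma> i \<in> G) \<Longrightarrow>
        (\<forall>x\<in>I. (\<Sum>i<n. c i * w (\<gamma> i) (T i) x) = 0) \<Longrightarrow> \<forall>i<n. c i = 0"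
      by (metis Suc_leD)
    have "\<exists>a\<in>A. \<forall>i<n. (\<Sum>x\<in>I. a x * w (\<gamma> i) (T i) x) = 0" for \<gamma> :: "nat \<Rightarrow> 'g"
      using ann[of n "\<lambda>i. w (\<gamma> i) (T i)"] Suc.prems by simp
    then obtain a where a: "\<And>\<gamma>. a \<gamma> \<in> A"
      "\<And>\<gamma> i. i < n \<Longrightarrow> (\<Sum>x\<in>I. a \<gamma> x * w (\<gamma> i) (T i) x) = 0"
      by metis
    \<comment> \<open>Extensional functions on \<open>{..<n}\<close> form a finite set, so only
      finitely many translates of the earlier vectors have to be considered.\<close>
    define bad where "bad = (\<Union>\<gamma>\<in>{..<n} \<rightarrow>\<^sub>E G. \<Union>g\<in>G. {t. (\<Sum>x\<in>I. a \<gamma> x * w g t x) = 0})"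
    have "finite bad"
      unfolding bad_def using \<open>finite G\<close> a(1) fin by (intro finite_UN_I finite_PiE) auto
    then obtain t where t: "t \<notin> bad"
      using ex_new_if_finite[OF infinite_UNIV_char_0] by blast
    show ?case
    proof (intro exI[of _ "T(n := t)"] allI impI)
      fix \<gamma> :: "nat \<Rightarrow> 'g" and c :: "nat \<Rightarrow> real" and i
      assume \<gamma>: "\<forall>i<Suc n. \<gamma> i \<in> G" and i: "i < Suc n"
        and z: "\<forall>x\<in>I. (\<Sum>i<Suc n. c i * w (\<gamma> i) ((T(n := t)) i) x) = 0"
      have z': "(\<Sum>i<n. c i * w (\<gamma> i) (T i) x) + c n * w (\<gamma> n) t x = 0" if "x \<in> I" for x
        using z that by (simp cong: sum.cong_simp)
      define \<delta> where "\<delta> = restrict \<gamma> {..<n}"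
      have \<delta>: "\<delta> \<in> {..<n} \<rightarrow>\<^sub>E G" using \<gamma> by (auto simp: \<delta>_def)
      \<comment> \<open>Pairing the relation with the functional \<open>a \<delta>\<close> kills the
        first \<open>n\<close> vectors. What remains is \<open>c n\<close> times a number that is
        nonzero because \<open>t\<close> avoids \<open>bad\<close>.\<close>
      have "0 = (\<Sum>x\<in>I. a \<delta> x * ((\<Sum>i<n. c i * w (\<gamma> i) (T i) x) + c n * w (\<gamma> n) t x))"
        using z' by simp
      also have "\<dots> = (\<Sum>x\<in>I. \<Sum>i<n. c i * (a \<delta> x * w (\<gamma> i) (T i) x))
          + c n * (\<Sum>x\<in>I. a \<delta> x * w (\<gamma> n) t x)"
        by (simp add: algebra_simps sum.distrib sum_distrib_left)
      also have "(\<Sum>x\<in>I. \<Sum>i<n. c i * (a \<delta> x * w (\<gamma> i) (T i) x))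
          = (\<Sum>i<n. c i * (\<Sum>x\<in>I. a \<delta> x * w (\<delta> i) (T i) x))"
        by (subst sum.swap) (simp add: sum_distrib_left \<delta>_def)
      also have "\<dots> = 0" using a(2) by simp
      finally have "c n = 0" using t \<gamma> \<delta> by (auto simp: bad_def)
      moreover have "\<forall>i<n. c i = 0"
        using \<gamma> z' \<open>c n = 0\<close> by (intro T[of \<gamma>]) auto
      ultimately show "c i = 0" using i by (auto simp: less_Suc_eq)
    qed
  qed
  then show ?thesis by blast
qed

subsection \<open>The group action on configurations\<close>

definition sdiff :: "nat set \<Rightarrow> nat set \<Rightarrow> nat set" where
  "sdiff A B = (A - B) \<union> (B - A)"

text \<open>The hyperoctahedral group (Z/2)^k : S_k in the encoding of \<open>actZ\<close> and
  \<open>actU\<close>; \<open>wmul\<close> and \<open>winv\<close> are its semidirect product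
  operations.\<close>

definition wgrp :: "nat \<Rightarrow> (nat set \<times> (nat \<Rightarrow> nat)) set" where
  "wgrp k = Pow {..<k} \<times> {\<tau>. \<tau> permutes {..<k}}"

definition wmul :: "nat set \<times> (nat \<Rightarrow> nat) \<Rightarrow> nat set \<times> (nat \<Rightarrow> nat) \<Rightarrow> nat set \<times> (nat \<Rightarrow> nat)" where
  "wmul g h = (sdiff (fst g) (snd g ` fst h), snd g \<circ> snd h)"

definition winv :: "nat set \<times> (nat \<Rightarrow> nat) \<Rightarrow> nat set \<times> (nat \<Rightarrow> nat)" where
  "winv g = (inv (snd g) ` fst g, inv (snd g))"

definition wact :: "nat set \<times> (nat \<Rightarrow> nat) \<Rightarrow> (nat \<Rightarrow> nat \<Rightarrow> real) \<Rightarrow> (nat \<Rightarrow> nat \<Rightarrow> real)" where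
  "wact g X = actZ (fst g) (snd g) X"

definition windex :: "nat set \<times> (nat \<Rightarrow> nat) \<Rightarrow> nat set \<Rightarrow> nat set" where
  "windex g \<alpha> = sdiff (fst g) (snd g ` \<alpha>)"

lemma mem_sdiff: "x \<in> sdiff A B \<longleftrightarrow> (x \<in> A) \<noteq> (x \<in> B)"
  by (auto simp: sdiff_def)

lemma sdiff_cancel: "sdiff A C = sdiff B C \<longleftrightarrow> A = B" "sdiff C A = sdiff C B \<longleftrightarrow> A = B"
  by (auto simp: set_eq_iff mem_sdiff)

lemma sdiff_cancel_same: "sdiff A (sdiff A B) = B" "sdiff A A = {}" "sdiff A {} = A"
  by (auto simp: set_eq_iff mem_sdiff)

lemma sdiff_assoc: "sdiff (sdiff A B) C = sdiff A (sdiff B C)"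
  by (auto simp: set_eq_iff mem_sdiff)

lemma image_sdiff: "inj f \<Longrightarrow> f ` sdiff A B = sdiff (f ` A) (f ` B)"
  by (auto simp: sdiff_def inj_image_mem_iff image_Un image_set_diff)

lemma wgrpD:
  assumes "g \<in> wgrp k"
  shows "fst g \<subseteq> {..<k}" "snd g permutes {..<k}" "inj (snd g)" "surj (snd g)"
proof -
  show *: "fst g \<subseteq> {..<k}" "snd g permutes {..<k}" using assms by (auto simp: wgrp_def)
  show "inj (snd g)" "surj (snd g)" using permutes_inj[OF *(2)] permutes_surj[OF *(2)] by auto
qed

lemma finite_wgrp: "finite (wgrp k)"
  by (simp add: wgrp_def finite_permutations)

lemma wmul_wgrp:
  assumes "g \<in> wgrp k" "h \<in> wgrp k"
  shows "wmul g h \<in> wgrp k"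
proof -
  have "snd g ` fst h \<subseteq> {..<k}"
    using wgrpD(1)[OF assms(2)] permutes_image[OF wgrpD(2)[OF assms(1)]] by blast
  moreover have "(snd g \<circ> snd h) permutes {..<k}"
    by (rule permutes_compose[OF wgrpD(2)[OF assms(2)] wgrpD(2)[OF assms(1)]])
  ultimately show ?thesis
    using wgrpD(1)[OF assms(1)] by (auto simp: wgrp_def wmul_def sdiff_def)
qed

lemma winv_wgrp:
  assumes "g \<in> wgrp k"
  shows "winv g \<in> wgrp k"
  using wgrpD[OF assms] permutes_inv[of "snd g" "{..<k}"]
    permutes_image[OF permutes_inv[of "snd g" "{..<k}"]]
  by (auto simp: wgrp_def winv_def)

lemma wact_wmul:
  assumes "g \<in> wgrp k" "h \<in> wgrp k"
  shows "wact (wmul g h) X = wact g (wact h X)"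
proof -
  note g = wgrpD[OF assms(1)] and h = wgrpD[OF assms(2)]
  have "inv (snd g \<circ> snd h) = inv (snd h) \<circ> inv (snd g)"
    using g h by (intro o_inv_distrib) (auto simp: bij_def)
  moreover have "i \<in> snd g ` fst h \<longleftrightarrow> inv (snd g) i \<in> fst h" for i
    using inv_f_f[OF g(3)] surj_f_inv_f[OF g(4)] by (auto intro: image_eqI[where x = "inv (snd g) i"])
  ultimately show ?thesis
    by (auto simp: wact_def wmul_def actZ_def fun_eq_iff mem_sdiff)
qed

lemma wact_winv:
  assumes "g \<in> wgrp k"
  shows "wact g (wact (winv g) X) = X"
proof -
  note g = wgrpD[OF assms]
  have "wmul g (winv g) = ({}, id)"
    using surj_f_inv_f[OF g(4)]
    by (simp add: wmul_def winv_def image_image sdiff_cancel_same fun_eq_iff)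
  moreover have "wact ({}, id) X = X" by (simp add: wact_def actZ_def)
  ultimately show ?thesis
    using wact_wmul[OF assms winv_wgrp[OF assms], of X] by metis
qed

text \<open>Right translations reindex the sum over the group from which the map is built; this
  yields its equivariance.\<close>

lemma bij_wmul:
  assumes "h \<in> wgrp k"
  shows "bij_betw (\<lambda>g. wmul g h) (wgrp k) (wgrp k)"
proof -
  have "inj_on (\<lambda>g. wmul g h) (wgrp k)"
  proof (rule inj_onI)
    fix g g' assume "wmul g h = wmul g' h"
    moreover from this have "snd g = snd g'"
      using wgrpD(4)[OF assms] by (simp add: wmul_def surj_fun_eq)
    ultimately show "g = g'" by (simp add: wmul_def sdiff_cancel prod_eq_iff)
  qed
  then show ?thesis
    using finite_wgrp wmul_wgrp[OF _ assms] by (simp add: bij_betw_def endo_inj_surj image_subset_iff)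
qed

lemma windex_wmul:
  assumes "g \<in> wgrp k"
  shows "windex (wmul g h) \<alpha> = windex g (windex h \<alpha>)"
  using wgrpD(3)[OF assms] by (simp add: windex_def wmul_def image_sdiff sdiff_assoc image_comp)

lemma bij_windex:
  assumes "g \<in> wgrp k"
  shows "bij_betw (windex g) (Pow {..<k}) (Pow {..<k})"
proof -
  note g = wgrpD[OF assms]
  have "inj (windex g)"
    using g(3) by (auto intro!: injI simp: windex_def sdiff_cancel inj_image_eq_iff)
  moreover have "windex g ` Pow {..<k} \<subseteq> Pow {..<k}"
    using g(1) permutes_image[OF g(2)] by (auto simp: windex_def sdiff_def)
  ultimately show ?thesis
    using endo_inj_surj[of "Pow {..<k}" "windex g"] inj_on_subset[of "windex g" UNIV]
    by (simp add: bij_betw_def)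
qed

text \<open>The action on U in the form (g y)_(g \<alpha>) = y_\<alpha>. Since
  \<open>windex g\<close> is surjective, equivariance can be checked at indices of this form,
  without inverses.\<close>

lemma actU_windex:
  assumes "g \<in> wgrp k"
  shows "actU (fst g) (snd g) Y l (windex g \<alpha>) = Y l \<alpha>"
  using wgrpD(3)[OF assms]
  by (simp add: actU_def windex_def image_comp sdiff_def[symmetric] sdiff_cancel_same)

lemma windex_subset_iff:
  assumes "g \<in> wgrp k"
  shows "windex g \<alpha> \<subseteq> {..<k} \<longleftrightarrow> \<alpha> \<subseteq> {..<k}"
proof -
  note g = wgrpD[OF assms]
  have "snd g ` \<alpha> \<subseteq> {..<k} \<longleftrightarrow> \<alpha> \<subseteq> {..<k}"
    using permutes_in_image[OF g(2)] by auto
  then show ?thesis using g(1) by (auto simp: windex_def sdiff_def)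
qed

lemma surj_windex:
  assumes "g \<in> wgrp k"
  shows "\<exists>\<gamma>. \<alpha> = windex g \<gamma>"
proof -
  have "windex g (inv (snd g) ` sdiff (fst g) \<alpha>) = \<alpha>"
    using surj_f_inv_f[OF wgrpD(4)[OF assms]]
    by (simp add: windex_def image_image sdiff_cancel_same)
  then show ?thesis by metis
qed

section \<open>Configurations under the group, and an invariant distance\<close>

lemma Zdk_D:
  assumes "X \<in> Zdk d k" "r < k"
  shows "i > d \<Longrightarrow> X r i = 0" "\<exists>i\<le>d. X r i \<noteq> 0"
proof -
  have s: "sphere_pt d (X r)" using assms by (simp add: Zdk_def)
  then show "i > d \<Longrightarrow> X r i = 0" by (simp add: sphere_pt_def)
  show "\<exists>i\<le>d. X r i \<noteq> 0"
  proof (rule ccontr)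
    assume "\<not> ?thesis"
    then have "(\<Sum>i\<le>d. (X r i)^2) = 0" by (intro sum.neutral) auto
    with s show False by (simp add: sphere_pt_def)
  qed
qed

lemma wact_in_Zdk:
  assumes "g \<in> wgrp k" "X \<in> Zdk d k"
  shows "wact g X \<in> Zdk d k"
proof -
  note g = wgrpD[OF assms(1)]
  let ?i = "inv (snd g)"
  have p: "?i permutes {..<k}" using g(2) by (rule permutes_inv)
  have lt: "?i r < k \<longleftrightarrow> r < k" for r using permutes_in_image[OF p, of r] by simp
  have X: "X r \<noteq> X s" "X r \<noteq> (\<lambda>i. - X s i)" if "r < k" "s < k" "r \<noteq> s" for r s
  proof -
    have "X r \<noteq> X s \<and> X r \<noteq> (\<lambda>i. - X s i)"
    proof (cases "r < s")
      case True then show ?thesis using assms(2) that by (auto simp: Zdk_def)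
    next
      case False
      then have "X s \<noteq> X r" "X s \<noteq> (\<lambda>i. - X r i)"
        using assms(2) that by (auto simp: Zdk_def)
      moreover have "X s = (\<lambda>i. - X r i)" if "X r = (\<lambda>i. - X s i)" using that by (simp add: fun_eq_iff)
      ultimately show ?thesis by metis
    qed
    then show "X r \<noteq> X s" "X r \<noteq> (\<lambda>i. - X s i)" by auto
  qed
  have ne: "?i r \<noteq> ?i s" if "r < s" for r s
    using permutes_inj[OF p] that by (metis injD less_irrefl)
  have sp: "sphere_pt d (wact g X r)" if "r < k" for r
    using assms(2) that lt by (auto simp: Zdk_def wact_def actZ_def sphere_pt_def)
  have z: "wact g X r = (\<lambda>_. 0)" if "r \<ge> k" for r
    using assms(2) that lt[of r] by (auto simp: Zdk_def wact_def actZ_def)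
  have "wact g X r \<noteq> wact g X s \<and> wact g X r \<noteq> (\<lambda>i. - wact g X s i)" if "r < s" "s < k" for r s
    using X[of "?i r" "?i s"] ne[OF that(1)] lt that
    by (auto simp: wact_def actZ_def fun_eq_iff) (metis minus_equation_iff)
  with sp z show ?thesis by (simp add: Zdk_def)
qed

text \<open>This separates points of \<open>Zdk d k\<close>, whose other coordinates vanish. As a
  finite sum it is continuous for the product topology, and the group preserves it.\<close>

definition l1dist :: "nat \<Rightarrow> nat \<Rightarrow> (nat \<Rightarrow> nat \<Rightarrow> real) \<Rightarrow> (nat \<Rightarrow> nat \<Rightarrow> real) \<Rightarrow> real" where
  "l1dist d k X Y = (\<Sum>r<k. \<Sum>i\<le>d. \<bar>X r i - Y r i\<bar>)"

lemma l1dist_sym: "l1dist d k X Y = l1dist d k Y X"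
  by (simp add: l1dist_def abs_minus_commute)

lemma l1dist_self [simp]: "l1dist d k X X = 0"
  by (simp add: l1dist_def)

lemma l1dist_triangle: "l1dist d k X Z \<le> l1dist d k X Y + l1dist d k Y Z"
  unfolding l1dist_def sum.distrib[symmetric] by (intro sum_mono) auto

lemma l1dist_nonneg: "0 \<le> l1dist d k X Y"
  by (simp add: l1dist_def sum_nonneg)

lemma l1dist_coord: "r < k \<Longrightarrow> i \<le> d \<Longrightarrow> \<bar>X r i - Y r i\<bar> \<le> l1dist d k X Y"
  unfolding l1dist_def
  by (rule order_trans[OF member_le_sum[of i "{..d}"] member_le_sum[of r "{..<k}"]])
     (auto intro: sum_nonneg)

lemma l1dist_wact:
  assumes "g \<in> wgrp k"
  shows "l1dist d k (wact g X) (wact g Y) = l1dist d k X Y"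
proof -
  have "l1dist d k (wact g X) (wact g Y)
      = (\<Sum>r<k. \<Sum>i\<le>d. \<bar>X (inv (snd g) r) i - Y (inv (snd g) r) i\<bar>)"
    unfolding l1dist_def wact_def actZ_def by (intro sum.cong) auto
  also have "\<dots> = l1dist d k X Y"
    unfolding l1dist_def
    using sum.permute[OF permutes_inv[OF wgrpD(2)[OF assms]], of "\<lambda>r. \<Sum>i\<le>d. \<bar>X r i - Y r i\<bar>"]
    by (simp add: comp_def)
  finally show ?thesis .
qed

subsection \<open>Affine forms and the rank of a configuration\<close>

definition lead :: "(nat \<Rightarrow> real) \<Rightarrow> nat" where
  "lead x = (LEAST i. x i \<noteq> 0)"

text \<open>A representative of the line through \<open>x\<close>: it is the same for
  \<open>x\<close> and its antipode, so only the permutations act on the affine forms of a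
  configuration.\<close>

definition affine_form :: "(nat \<Rightarrow> real) \<Rightarrow> nat \<Rightarrow> real" where
  "affine_form x = (\<lambda>i. x i / x (lead x))"

definition truncated_form :: "nat \<Rightarrow> (nat \<Rightarrow> real) \<Rightarrow> nat \<Rightarrow> real" where
  "truncated_form m x = (\<lambda>i. if i \<le> m then affine_form x i else 0)"

definition lexless :: "(nat \<Rightarrow> real) \<Rightarrow> (nat \<Rightarrow> real) \<Rightarrow> bool" where
  "lexless a b \<longleftrightarrow> (\<exists>i. a i < b i \<and> (\<forall>j<i. a j = b j))"

lemma lead_nz: "x i \<noteq> 0 \<Longrightarrow> x (lead x) \<noteq> 0"
  unfolding lead_def by (rule LeastI)

lemma lead_le: "x i \<noteq> 0 \<Longrightarrow> lead x \<le> i"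
  unfolding lead_def by (rule Least_le)

lemma less_lead: "i < lead x \<Longrightarrow> x i = 0"
  using lead_le[of x i] by auto

lemma lead_eqI: "x i \<noteq> 0 \<Longrightarrow> (\<And>j. j < i \<Longrightarrow> x j = 0) \<Longrightarrow> lead x = i"
  unfolding lead_def by (rule Least_equality) (auto simp: not_le[symmetric])

lemma affine_form_less_lead: "i < lead x \<Longrightarrow> affine_form x i = 0"
  using less_lead[of i x] by (simp add: affine_form_def)

lemma affine_form_lead: "x i \<noteq> 0 \<Longrightarrow> affine_form x (lead x) = 1"
  using lead_nz[of x i] by (simp add: affine_form_def)

lemma lead_scale: "c \<noteq> 0 \<Longrightarrow> lead (\<lambda>i. c * x i) = lead x"
  by (simp add: lead_def)

lemma affine_form_scale: "c \<noteq> 0 \<Longrightarrow> affine_form (\<lambda>i. c * x i) = affine_form x"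
  by (simp add: affine_form_def lead_scale)

lemma truncated_form_scale: "c \<noteq> 0 \<Longrightarrow> truncated_form m (\<lambda>i. c * x i) = truncated_form m x"
  by (simp add: truncated_form_def affine_form_scale fun_eq_iff)

lemma lexless_trans: "lexless a b \<Longrightarrow> lexless b c \<Longrightarrow> lexless a c"
  unfolding lexless_def
proof (elim exE conjE)
  fix i j assume i: "a i < b i" "\<forall>l<i. a l = b l" and j: "b j < c j" "\<forall>l<j. b l = c l"
  have "a (min i j) < c (min i j)"
    using i j by (cases i j rule: linorder_cases) (auto simp: min_def)
  moreover have "\<forall>l<min i j. a l = c l" using i j by auto
  ultimately show "\<exists>i. a i < c i \<and> (\<forall>j<i. a j = c j)" by blast
qed

lemma lexless_irrefl: "\<not> lexless a a"
  by (simp add: lexless_def)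

lemma lexless_linear:
  assumes "a \<noteq> b"
  shows "lexless a b \<or> lexless b a"
proof -
  define i where "i = (LEAST i. a i \<noteq> b i)"
  have "\<exists>i. a i \<noteq> b i" using assms by (simp add: fun_eq_iff)
  then have "a i \<noteq> b i" unfolding i_def by (rule LeastI_ex)
  moreover have "\<forall>j<i. a j = b j" unfolding i_def using not_less_Least[of _ "\<lambda>i. a i \<noteq> b i"] by blast
  ultimately show ?thesis unfolding lexless_def
    by (cases "a i" "b i" rule: linorder_cases) (auto intro!: exI[of _ i])
qed

text \<open>Both truncations are nonzero, so their forms agree exactly when they are proportional,
  that is, when all 2x2 minors vanish. Minors are polynomial, hence disagreement is an open
  condition, whatever happens to the leading positions.\<close>

lemma truncated_form_eq_iff:
  assumes "lead x \<le> m" "lead y \<le> m" "x p \<noteq> 0" "y q \<noteq> 0"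
  shows "truncated_form m x = truncated_form m y \<longleftrightarrow> (\<forall>i\<le>m. \<forall>j\<le>m. x i * y j = x j * y i)"
proof
  have nz: "x (lead x) \<noteq> 0" "y (lead y) \<noteq> 0" using assms(3,4) lead_nz by auto
  {
    assume "truncated_form m x = truncated_form m y"
    then have *: "affine_form x i = affine_form y i" if "i \<le> m" for i
      using that by (metis truncated_form_def)
    have xy: "x i = x (lead x) * affine_form x i" "y i = y (lead y) * affine_form y i" for i
      using nz by (auto simp: affine_form_def)
    show "\<forall>i\<le>m. \<forall>j\<le>m. x i * y j = x j * y i"
    proof (intro allI impI)
      fix i j assume "i \<le> m" "j \<le> m"
      then have "x i = x (lead x) * affine_form y i" "x j = x (lead x) * affine_form y j"
        using xy * by metis+
      with xy(2)[of i] xy(2)[of j] show "x i * y j = x j * y i"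
        by (metis mult.assoc mult.commute)
    qed
  }
  {
    assume m: "\<forall>i\<le>m. \<forall>j\<le>m. x i * y j = x j * y i"
    define c where "c = y (lead x) / x (lead x)"
    have y: "y i = c * x i" if "i \<le> m" for i
    proof -
      have "x i * y (lead x) = x (lead x) * y i" using m that assms(1) by blast
      then show ?thesis using nz by (simp add: c_def field_simps)
    qed
    have c: "c \<noteq> 0" using y[OF assms(2)] nz(2) by auto
    have "lead y = lead x"
      by (rule lead_eqI) (use y assms(1) c nz(1) less_lead[of _ x] in auto)
    then show "truncated_form m x = truncated_form m y"
      using y assms(1) c by (auto simp: truncated_form_def affine_form_def fun_eq_iff)
  }
qed

lemma card_image_refine:
  assumes "finite D'" "D \<subseteq> D'"
    and "\<And>r s. r \<in> D \<Longrightarrow> s \<in> D \<Longrightarrow> f' r = f' s \<Longrightarrow> f r = f s"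
  shows "card (f ` D) \<le> card (f' ` D')"
    and "card (f ` D) = card (f' ` D') \<Longrightarrow> f' ` D' = f' ` D"
    and "card (f ` D) = card (f' ` D') \<Longrightarrow> r \<in> D \<Longrightarrow> s \<in> D \<Longrightarrow> f r = f s \<Longrightarrow> f' r = f' s"
proof -
  define h where "h y = f (SOME r. r \<in> D \<and> f' r = y)" for y
  have h: "h (f' r) = f r" if "r \<in> D" for r
    unfolding h_def using assms(3) that by (metis (mono_tags, lifting) someI_ex)
  have im: "f ` D = h ` f' ` D" using h by (force simp: image_iff)
  have fin: "finite D" "finite (f' ` D)" "finite (f' ` D')"
    using assms(1,2) finite_subset by auto
  have le: "card (f ` D) \<le> card (f' ` D)" "card (f' ` D) \<le> card (f' ` D')"
    using im fin card_image_le[of "f' ` D" h] assms(2) by (auto intro: card_mono image_mono)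
  then show "card (f ` D) \<le> card (f' ` D')" by simp
  assume eq: "card (f ` D) = card (f' ` D')"
  show "f' ` D' = f' ` D"
    using le eq card_subset_eq[OF fin(3), of "f' ` D"] assms(2) by auto
  have "inj_on h (f' ` D)"
    using le eq im fin by (intro eq_card_imp_inj_on) auto
  then show "f' r = f' s" if "r \<in> D" "s \<in> D" "f r = f s"
    using that h by (metis image_eqI inj_onD)
qed

text \<open>A row with its first nonzero coordinate at position m is excluded, since its truncated form is
  forced. This is what makes the number of values of the rank small enough.\<close>

definition form_count :: "nat \<Rightarrow> nat \<Rightarrow> (nat \<Rightarrow> nat \<Rightarrow> real) \<Rightarrow> nat" where
  "form_count k m X = card ((\<lambda>r. truncated_form m (X r)) ` {r. r < k \<and> lead (X r) < m})"

definition form_rank :: "nat \<Rightarrow> nat \<Rightarrow> (nat \<Rightarrow> nat \<Rightarrow> real) \<Rightarrow> nat" where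
  "form_rank d k X = (\<Sum>m=1..d. form_count k m X)"

definition canonical :: "nat \<Rightarrow> (nat \<Rightarrow> nat \<Rightarrow> real) \<Rightarrow> bool" where
  "canonical k X \<longleftrightarrow> (\<forall>r<k. X r (lead (X r)) > 0) \<and>
     (\<forall>r s. r < s \<and> s < k \<longrightarrow> lexless (affine_form (X r)) (affine_form (X s)))"

lemma Zdk_lead:
  assumes "X \<in> Zdk d k" "r < k"
  shows "X r (lead (X r)) \<noteq> 0" "lead (X r) \<le> d"
  using Zdk_D(2)[OF assms] lead_nz[of "X r"] lead_le[of "X r"] by (auto intro: order_trans)

text \<open>Equal affine forms make two rows proportional; unit length forces the factor 1 or -1,
  which a configuration excludes.\<close>

lemma affine_form_inj:
  assumes X: "X \<in> Zdk d k" and rs: "r < k" "s < k" "r \<noteq> s"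
  shows "affine_form (X r) \<noteq> affine_form (X s)"
proof
  assume a: "affine_form (X r) = affine_form (X s)"
  define c where "c = X r (lead (X r)) / X s (lead (X s))"
  note nz = Zdk_lead(1)[OF X rs(1)] Zdk_lead(1)[OF X rs(2)]
  have c: "X r i = c * X s i" for i
    using fun_cong[OF a, of i] nz by (simp add: affine_form_def c_def field_simps)
  have "(\<Sum>i\<le>d. (X r i)^2) = c^2 * (\<Sum>i\<le>d. (X s i)^2)"
    by (simp add: c power_mult_distrib sum_distrib_left)
  then have "c^2 = 1" using X rs by (simp add: Zdk_def sphere_pt_def)
  then have "c = 1 \<or> c = -1" by (simp add: power2_eq_1_iff)
  then have "X r = X s \<or> X r = (\<lambda>i. - X s i) \<and> X s = (\<lambda>i. - X r i)"
    using c by (auto simp: fun_eq_iff)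
  moreover have "X r \<noteq> X s \<and> X r \<noteq> (\<lambda>i. - X s i) \<or> X s \<noteq> X r \<and> X s \<noteq> (\<lambda>i. - X r i)"
    using X rs by (cases r s rule: linorder_cases) (auto simp: Zdk_def)
  ultimately show False by auto
qed

lemma form_rank_le: "form_rank d k X \<le> d * k"
proof -
  have "form_count k m X \<le> k" for m
  proof -
    have "form_count k m X \<le> card {r. r < k \<and> lead (X r) < m}"
      unfolding form_count_def by (intro card_image_le) auto
    also have "\<dots> \<le> card {..<k}" by (intro card_mono) auto
    finally show ?thesis by simp
  qed
  then have "form_rank d k X \<le> (\<Sum>m=1..d. k)" unfolding form_rank_def by (intro sum_mono)
  then show ?thesis by simp
qed

text \<open>The level m = d alone contributes k - 1: there the truncated forms are the full,
  pairwise distinct affine forms, and at most one row is left out, since a row with leading position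
  d has the last unit vector as its form.\<close>

lemma form_rank_ge:
  assumes X: "X \<in> Zdk d k" and d: "d \<ge> 1"
  shows "k - 1 \<le> form_rank d k X"
proof -
  let ?S = "{r. r < k \<and> lead (X r) < d}"
  have tr: "truncated_form d (X r) = affine_form (X r)" if "r < k" for r
    using Zdk_D(1)[OF X that] by (auto simp: truncated_form_def affine_form_def fun_eq_iff)
  have "affine_form (X r) = (\<lambda>i. if i = d then 1 else 0)" if "r < k" "\<not> lead (X r) < d" for r
  proof -
    have "lead (X r) = d" using Zdk_lead(2)[OF X that(1)] that(2) by simp
    moreover have "X r i = 0" if "i \<noteq> d" for i
      using \<open>lead (X r) = d\<close> Zdk_D(1)[OF X \<open>r < k\<close>, of i] less_lead[of i "X r"] that by force
    ultimately show ?thesis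
      using Zdk_lead(1)[OF X that(1)] by (auto simp: affine_form_def fun_eq_iff)
  qed
  then have "r = s" if "r \<in> {..<k} - ?S" "s \<in> {..<k} - ?S" for r s
    using affine_form_inj[OF X, of r s] that by auto
  then have "card ({..<k} - ?S) \<le> 1"
    by (auto simp: card_le_Suc0_iff_eq)
  moreover have "card ({..<k} - ?S) = k - card ?S"
    by (subst card_Diff_subset) auto
  moreover have "inj_on (\<lambda>r. truncated_form d (X r)) ?S"
    using affine_form_inj[OF X] tr by (auto intro!: inj_onI) metis
  then have "form_count k d X = card ?S" unfolding form_count_def by (rule card_image)
  moreover have "form_count k d X \<le> form_rank d k X"
    unfolding form_rank_def using d by (intro member_le_sum) auto
  ultimately show ?thesis by linarith
qed

lemma wact_row:
  assumes "g \<in> wgrp k"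
  shows "lead (wact g X r) = lead (X (inv (snd g) r))"
    "affine_form (wact g X r) = affine_form (X (inv (snd g) r))"
    "truncated_form m (wact g X r) = truncated_form m (X (inv (snd g) r))"
  by (simp_all add: wact_def actZ_def lead_scale affine_form_scale truncated_form_scale)

lemma form_rank_wact:
  assumes "g \<in> wgrp k"
  shows "form_rank d k (wact g X) = form_rank d k X"
proof -
  let ?i = "inv (snd g)"
  have p: "?i permutes {..<k}" by (rule permutes_inv[OF wgrpD(2)[OF assms]])
  have "{r. r < k \<and> lead (X r) < m} = ?i ` {r. r < k \<and> lead (X (?i r)) < m}" for m
  proof (intro equalityI subsetI)
    fix r assume r: "r \<in> {r. r < k \<and> lead (X r) < m}"
    then obtain s where "r = ?i s" "s < k" using permutes_image[OF p] by (auto simp: image_iff set_eq_iff)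
    with r show "r \<in> ?i ` {r. r < k \<and> lead (X (?i r)) < m}" by auto
  next
    fix r assume "r \<in> ?i ` {r. r < k \<and> lead (X (?i r)) < m}"
    then show "r \<in> {r. r < k \<and> lead (X r) < m}" using permutes_in_image[OF p] by auto
  qed
  then have "form_count k m (wact g X) = form_count k m X" for m
    by (simp add: form_count_def wact_row[OF assms] image_image)
  then show ?thesis by (simp add: form_rank_def)
qed

subsection \<open>Local constancy of the canonical form\<close>

text \<open>Finitely many strict conditions at \<open>X\<close>, arranged so that each is open in
  \<open>Y\<close>. Rows of \<open>Y\<close> are divided by their entry at the leading position of
  \<open>X\<close>, because their own leading position may be smaller.\<close>

definition near_rows :: "nat \<Rightarrow> nat \<Rightarrow> (nat \<Rightarrow> nat \<Rightarrow> real) \<Rightarrow> (nat \<Rightarrow> nat \<Rightarrow> real) \<Rightarrow> bool" where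
  "near_rows d k X Y \<longleftrightarrow>
    (\<forall>r\<in>{..<k}. X r (lead (X r)) > 0 \<longrightarrow> Y r (lead (X r)) > 0) \<and>
    (\<forall>r\<in>{..<k}. Y r (lead (X r)) \<noteq> 0) \<and>
    (\<forall>r\<in>{..<k}. \<forall>s\<in>{..<k}. \<forall>i\<in>{..d}. \<forall>j\<in>{..d}.
      X r i * X s j \<noteq> X r j * X s i \<longrightarrow> Y r i * Y s j \<noteq> Y r j * Y s i) \<and>
    (\<forall>r\<in>{..<k}. \<forall>s\<in>{..<k}. \<forall>i\<in>{..d}. affine_form (X r) i < affine_form (X s) i \<longrightarrow>
      Y r i / Y r (lead (X r)) < Y s i / Y s (lead (X s)))"

lemma near_rows_l1dist:
  assumes X: "X \<in> Zdk d k"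
  shows "\<exists>\<epsilon>>0. \<forall>Y. l1dist d k X Y < \<epsilon> \<longrightarrow> near_rows d k X Y"
proof -
  \<comment> \<open>The filter generated by the balls around \<open>X\<close>; entries of a
    configuration converge along it, so openness can be derived from limit rules.\<close>
  define F where "F = filtercomap (l1dist d k X) (nhds 0)"
  have t: "((\<lambda>Y. Y r i) \<longlongrightarrow> X r i) F" if "r < k" "i \<le> d" for r i
  proof (rule tendstoI)
    fix e :: real assume "e > 0"
    then have "eventually (\<lambda>t. t < e) (nhds 0)"
      by (auto simp: eventually_nhds_metric dist_real_def intro!: exI[of _ e])
    then show "eventually (\<lambda>Y. dist (Y r i) (X r i) < e) F"
      unfolding F_def eventually_filtercomap
      using l1dist_coord[OF that, of X]
      by (intro exI[of _ "\<lambda>t. t < e"]) (auto simp: dist_real_def abs_minus_commute intro: le_less_trans)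
  qed
  note nz = Zdk_lead[OF X]
  have "eventually (near_rows d k X) F"
    unfolding near_rows_def
  proof (intro eventually_conj eventually_ball_finite ballI)
    fix r assume r: "r \<in> {..<k}"
    show "eventually (\<lambda>Y. X r (lead (X r)) > 0 \<longrightarrow> Y r (lead (X r)) > 0) F"
      using r order_tendstoD(1)[OF t[of r "lead (X r)"], of 0] nz[of r]
      by (cases "X r (lead (X r)) > 0") auto
    show "eventually (\<lambda>Y. Y r (lead (X r)) \<noteq> 0) F"
      using r nz[of r] by (intro tendsto_imp_eventually_ne[OF t]) auto
    fix s i assume s: "s \<in> {..<k}" and i: "i \<in> {..d}"
    show "eventually (\<lambda>Y. affine_form (X r) i < affine_form (X s) i \<longrightarrow>
        Y r i / Y r (lead (X r)) < Y s i / Y s (lead (X s))) F"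
    proof (cases "affine_form (X r) i < affine_form (X s) i")
      case True
      have lim: "((\<lambda>Y. Y s i / Y s (lead (X s)) - Y r i / Y r (lead (X r)))
          \<longlongrightarrow> X s i / X s (lead (X s)) - X r i / X r (lead (X r))) F"
        using r s i nz by (intro tendsto_intros t) auto
      have "eventually (\<lambda>Y. 0 < Y s i / Y s (lead (X s)) - Y r i / Y r (lead (X r))) F"
        by (rule order_tendstoD(1)[OF lim]) (use True in \<open>simp add: affine_form_def\<close>)
      then show ?thesis by (rule eventually_mono) auto
    qed simp
    fix j assume j: "j \<in> {..d}"
    show "eventually (\<lambda>Y. X r i * X s j \<noteq> X r j * X s i \<longrightarrow>
        Y r i * Y s j \<noteq> Y r j * Y s i) F"
    proof (cases "X r i * X s j = X r j * X s i")
      case False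
      have lim: "((\<lambda>Y. Y r i * Y s j - Y r j * Y s i) \<longlongrightarrow> X r i * X s j - X r j * X s i) F"
        using r s i j by (intro tendsto_intros t) auto
      have "eventually (\<lambda>Y. Y r i * Y s j - Y r j * Y s i \<noteq> 0) F"
        by (rule tendsto_imp_eventually_ne[OF lim]) (use False in simp)
      then show ?thesis by (rule eventually_mono) auto
    qed simp
  qed simp_all
  then obtain Q where "eventually Q (nhds (0::real))" and Q: "\<And>Y. Q (l1dist d k X Y) \<Longrightarrow> near_rows d k X Y"
    unfolding F_def eventually_filtercomap by auto
  then obtain \<epsilon> where \<epsilon>: "\<epsilon> > 0" "\<And>t. dist t 0 < \<epsilon> \<Longrightarrow> Q t"
    by (auto simp: eventually_nhds_metric)
  have "Q (l1dist d k X Y)" if "l1dist d k X Y < \<epsilon>" for Y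
    using \<epsilon>(2) that l1dist_nonneg[of d k X Y] by (simp add: dist_real_def)
  with \<epsilon>(1) Q show ?thesis by (intro exI[of _ \<epsilon>]) simp
qed

text \<open>Every summand of the rank is lower semicontinuous, so where the rank is constant the
  coincidences among the truncated affine forms cannot change.\<close>

lemma canonical_near:
  assumes X: "X \<in> Zdk d k" and can: "canonical k X"
  shows "\<exists>\<epsilon>>0. \<forall>Y\<in>Zdk d k. l1dist d k X Y < \<epsilon> \<and> form_rank d k Y = form_rank d k X \<longrightarrow> canonical k Y"
proof -
  obtain \<epsilon> where \<epsilon>: "\<epsilon> > 0" and near: "\<And>Y. l1dist d k X Y < \<epsilon> \<Longrightarrow> near_rows d k X Y"
    using near_rows_l1dist[OF X] by blast
  have "canonical k Y"
    if Y: "Y \<in> Zdk d k" and dist: "l1dist d k X Y < \<epsilon>" and rk: "form_rank d k Y = form_rank d k X" for Y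
  proof -
    have near_sign: "Y r (lead (X r)) > 0" if "r < k" for r
      using near[OF dist, unfolded near_rows_def] can that by (auto simp: canonical_def)
    have near_minor: "Y r i * Y s j \<noteq> Y r j * Y s i"
      if "r < k" "s < k" "i \<le> d" "j \<le> d" "X r i * X s j \<noteq> X r j * X s i" for r s i j
      using near[OF dist, unfolded near_rows_def] that by auto
    have near_less: "Y r i / Y r (lead (X r)) < Y s i / Y s (lead (X s))"
      if "r < k" "s < k" "i \<le> d" "affine_form (X r) i < affine_form (X s) i" for r s i
      using near[OF dist, unfolded near_rows_def] that by auto
    \<comment> \<open>Under a small perturbation a leading position can only move to the
      left.\<close>
    have le: "lead (Y r) \<le> lead (X r)" if "r < k" for r
      using near_sign[OF that] by (intro lead_le) auto
    \<comment> \<open>Coincidences for \<open>Y\<close> come from coincidences for \<open>X\<close>,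
      as nonzero minors stay nonzero. Leading position equal to \<open>m\<close> is allowed here,
      although the counts exclude it; this case is used to show that leading positions are
      constant.\<close>
    have refine: "truncated_form m (X r) = truncated_form m (X s)"
      if "r < k" "s < k" "lead (X r) \<le> m" "lead (X s) \<le> m" "m \<le> d"
        and eq: "truncated_form m (Y r) = truncated_form m (Y s)" for r s m
    proof -
      have "\<forall>i\<le>m. \<forall>j\<le>m. Y r i * Y s j = Y r j * Y s i"
        using eq Zdk_lead(1)[OF Y] le[of r] le[of s] that
        by (subst truncated_form_eq_iff[symmetric]) (auto intro: order_trans)
      then have "\<forall>i\<le>m. \<forall>j\<le>m. X r i * X s j = X r j * X s i"
        using near_minor that by (meson order_trans)
      then show ?thesis
        using Zdk_lead(1)[OF X] that by (subst truncated_form_eq_iff) auto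
    qed
    let ?D = "\<lambda>m Y. {r. r < k \<and> lead (Y r) < m}"
    have sub: "?D m X \<subseteq> ?D m Y" for m using le by fastforce
    have ref: "truncated_form m (X r) = truncated_form m (X s)"
      if "m \<le> d" "r \<in> ?D m X" "s \<in> ?D m X" "truncated_form m (Y r) = truncated_form m (Y s)" for m r s
      using refine[of r s m] that by auto
    have mono: "form_count k m X \<le> form_count k m Y" if "m \<le> d" for m
      unfolding form_count_def
      by (rule card_image_refine(1)[OF _ sub ref]) (use that in auto)
    \<comment> \<open>The counts are termwise monotone and have equal sums, so they agree at every
      level.\<close>
    have lev: "form_count k m X = form_count k m Y" if "m \<in> {1..d}" for m
      using sum_mono_inv[of "\<lambda>m. form_count k m X" "{1..d}" "\<lambda>m. form_count k m Y" m] rk mono that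
      by (simp add: form_rank_def)
    have im: "(\<lambda>r. truncated_form m (Y r)) ` ?D m Y = (\<lambda>r. truncated_form m (Y r)) ` ?D m X" if "m \<in> {1..d}" for m
      by (rule card_image_refine(2)[OF _ sub ref lev[OF that, unfolded form_count_def]]) (use that in auto)
    have same: "truncated_form m (Y r) = truncated_form m (Y s)"
      if "m \<in> {1..d}" "r \<in> ?D m X" "s \<in> ?D m X" "truncated_form m (X r) = truncated_form m (X s)" for m r s
      by (rule card_image_refine(3)[OF _ sub ref lev[OF that(1), unfolded form_count_def] that(2-4)])
         (use that in auto)
    \<comment> \<open>If the leading position of row \<open>r\<close> dropped below its old value
      \<open>m\<close>, the row would enter the count at level \<open>m\<close> without adding a new
      form. It would then share its form with an old row \<open>s\<close>, also in \<open>X\<close>;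
      but there row \<open>r\<close> is still 0 where the form of row \<open>s\<close> is 1.\<close>
    have lead_eq: "lead (Y r) = lead (X r)" if r: "r < k" for r
    proof (rule ccontr)
      assume "lead (Y r) \<noteq> lead (X r)"
      then have l: "lead (Y r) < lead (X r)" using le[OF r] by simp
      define m where "m = lead (X r)"
      have m: "m \<in> {1..d}" using l Zdk_lead(2)[OF X r] by (simp add: m_def)
      have "truncated_form m (Y r) \<in> (\<lambda>r. truncated_form m (Y r)) ` ?D m Y" using l r by (simp add: m_def)
      then obtain s where s: "s < k" "lead (X s) < m" "truncated_form m (Y r) = truncated_form m (Y s)"
        using im[OF m] by auto
      have "truncated_form m (X r) = truncated_form m (X s)"
        using refine[OF r s(1), of m] s m by (simp add: m_def)
      then have "affine_form (X r) (lead (X s)) = affine_form (X s) (lead (X s))"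
        using s(2) by (metis less_imp_le truncated_form_def)
      moreover have "affine_form (X r) (lead (X s)) = 0" using s(2) by (simp add: m_def affine_form_less_lead)
      moreover have "affine_form (X s) (lead (X s)) = 1"
        using Zdk_lead(1)[OF X s(1)] by (rule affine_form_lead)
      ultimately show False by simp
    qed
    have nf: "affine_form (Y r) i = Y r i / Y r (lead (X r))" if "r < k" for r i
      using lead_eq[OF that] by (simp add: affine_form_def)
    show "canonical k Y"
      unfolding canonical_def
    proof (intro conjI allI impI)
      show "Y r (lead (Y r)) > 0" if "r < k" for r using near_sign lead_eq that by simp
      fix r s assume "r < s \<and> s < k"
      then have rs: "r < k" "s < k" and "lexless (affine_form (X r)) (affine_form (X s))"
        using can by (auto simp: canonical_def)
      then obtain i where i: "affine_form (X r) i < affine_form (X s) i" "\<And>j. j < i \<Longrightarrow> affine_form (X r) j = affine_form (X s) j"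
        by (auto simp: lexless_def)
      have "i \<le> d"
        using i(1) Zdk_D(1)[OF X rs(1), of i] Zdk_D(1)[OF X rs(2), of i]
        by (cases "i \<le> d") (auto simp: affine_form_def)
      have "affine_form (Y r) i < affine_form (Y s) i"
        using near_less[OF rs \<open>i \<le> d\<close> i(1)] nf rs by simp
      moreover have "affine_form (Y r) j = affine_form (Y s) j" if "j < i" for j
      \<comment> \<open>If both leading positions are below \<open>i - 1\<close>, the coincidence at
        level \<open>i - 1\<close> persists in \<open>Y\<close>. Otherwise both are at least
        \<open>i\<close>, or both equal \<open>i - 1\<close>, and the forms before \<open>i\<close>
        consist of forced entries 0 and 1.\<close>
      proof (cases "lead (X r) < i - 1 \<and> lead (X s) < i - 1")
        case True
        have "truncated_form (i - 1) (X r) = truncated_form (i - 1) (X s)"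
          using i(2) True by (auto simp: truncated_form_def fun_eq_iff)
        then have "truncated_form (i - 1) (Y r) = truncated_form (i - 1) (Y s)"
          using True \<open>i \<le> d\<close> rs by (intro same) auto
        then show ?thesis using that by (metis Suc_pred' less_Suc_eq_le not_less_zero neq0_conv truncated_form_def)
      next
        case False
        \<comment> \<open>At the smaller of two different leading positions one form is 1 and the
          other 0, which contradicts agreement before \<open>i\<close>.\<close>
        have eq1: "lead (X r) = lead (X s)" if "lead (X r) < i \<or> lead (X s) < i"
        proof (rule ccontr)
          assume ne: "lead (X r) \<noteq> lead (X s)"
          have 1: "affine_form (X r) (lead (X r)) = 1" "affine_form (X s) (lead (X s)) = 1"
            using Zdk_lead(1)[OF X] rs affine_form_lead by auto
          show False
          proof (cases "lead (X r) < lead (X s)")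
            case True
            then have "affine_form (X s) (lead (X r)) = 0" "lead (X r) < i"
              using that by (auto simp: affine_form_less_lead)
            with 1 i(2) show False by fastforce
          next
            case False
            with ne have "affine_form (X r) (lead (X s)) = 0" "lead (X s) < i"
              using that by (auto simp: affine_form_less_lead)
            with 1 i(2) show False by fastforce
          qed
        qed
        then have ge: "j < lead (Y r) \<and> j < lead (Y s) \<or> j = lead (Y r) \<and> j = lead (Y s)"
          using False \<open>j < i\<close> lead_eq rs by (cases "lead (X r) < i \<or> lead (X s) < i") auto
        then show ?thesis
          using affine_form_less_lead Zdk_lead(1)[OF Y] rs affine_form_lead by metis
      qed
      ultimately show "lexless (affine_form (Y r)) (affine_form (Y s))" unfolding lexless_def by blast
    qed
  qed
  with \<epsilon> show ?thesis by (intro exI[of _ \<epsilon>]) blast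
qed

subsection \<open>Equivariant bump functions\<close>

text \<open>The zero-based place of row \<open>r\<close> after sorting. Since \<open>actZ\<close>
  moves row \<open>r\<close> to place \<open>\<tau> r\<close>, this function is the sorting
  permutation itself.\<close>

definition order_index :: "nat \<Rightarrow> (nat \<Rightarrow> nat \<Rightarrow> real) \<Rightarrow> nat \<Rightarrow> nat" where
  "order_index k X r = card {s. s < k \<and> lexless (affine_form (X s)) (affine_form (X r))}"

lemma order_index_mono:
  assumes "r < k" "lexless (affine_form (X r)) (affine_form (X s))"
  shows "order_index k X r < order_index k X s"
  unfolding order_index_def
proof (rule psubset_card_mono)
  show "{t. t < k \<and> lexless (affine_form (X t)) (affine_form (X r))}
      \<subset> {t. t < k \<and> lexless (affine_form (X t)) (affine_form (X s))}"
    using assms lexless_trans lexless_irrefl by blast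
qed simp

lemma canonical_exists:
  assumes X: "X \<in> Zdk d k"
  shows "\<exists>g\<in>wgrp k. canonical k (wact g X)"
proof -
  let ?p = "order_index k X"
  have lin: "?p r < ?p s \<longleftrightarrow> lexless (affine_form (X r)) (affine_form (X s))" if "r < k" "s < k" for r s
    using order_index_mono[of r k X s] order_index_mono[of s k X r] that
      lexless_linear[OF affine_form_inj[OF X]] by (metis lexless_irrefl not_less_iff_gr_or_eq)
  have inj: "inj_on ?p {..<k}"
    using lin lexless_linear[OF affine_form_inj[OF X]]
    by (intro inj_onI) (metis lessThan_iff less_irrefl)
  have "?p r < k" if "r < k" for r
  proof -
    have "?p r < card {..<k}"
      unfolding order_index_def using that lexless_irrefl by (intro psubset_card_mono) auto
    then show ?thesis by simp
  qed
  then have bij: "bij_betw ?p {..<k} {..<k}"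
    using inj endo_inj_surj[of "{..<k}" ?p] by (auto simp: bij_betw_def)
  define \<tau> where "\<tau> = (\<lambda>r. if r \<in> {..<k} then ?p r else r)"
  have \<tau>: "\<tau> permutes {..<k}"
  proof (rule bij_imp_permutes)
    show "bij_betw \<tau> {..<k} {..<k}"
      using bij by (subst bij_betw_cong[of _ _ ?p]) (simp_all add: \<tau>_def)
  qed (simp add: \<tau>_def)
  \<comment> \<open>Signs are applied after the permutation, so \<open>\<beta>\<close> is indexed by
    the new places.\<close>
  define \<beta> where "\<beta> = {i. i < k \<and> X (inv \<tau> i) (lead (X (inv \<tau> i))) < 0}"
  have g: "(\<beta>, \<tau>) \<in> wgrp k" using \<tau> by (auto simp: wgrp_def \<beta>_def)
  have inv: "inv \<tau> i < k \<and> ?p (inv \<tau> i) = i" if "i < k" for i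
  proof -
    have "inv \<tau> i < k" using permutes_in_image[OF permutes_inv[OF \<tau>], of i] that by simp
    moreover have "\<tau> (inv \<tau> i) = i" using \<tau> by (rule permutes_inverses)
    ultimately show ?thesis by (simp add: \<tau>_def)
  qed
  have "canonical k (wact (\<beta>, \<tau>) X)"
    unfolding canonical_def wact_row[OF g]
  proof (intro conjI allI impI)
    fix r assume "r < k"
    then show "0 < wact (\<beta>, \<tau>) X r (lead (X (inv (snd (\<beta>, \<tau>)) r)))"
      using Zdk_lead(1)[OF X, of "inv \<tau> r"] inv[of r]
      by (auto simp: wact_def actZ_def \<beta>_def)
  next
    fix r s assume "r < s \<and> s < k"
    then show "lexless (affine_form (X (inv (snd (\<beta>, \<tau>)) r))) (affine_form (X (inv (snd (\<beta>, \<tau>)) s)))"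
      using inv[of r] inv[of s] lin[of "inv \<tau> r" "inv \<tau> s"] by simp
  qed
  with g show ?thesis by blast
qed

text \<open>A sorting permutation sends row \<open>r\<close> to the number of smaller rows, and
  positivity then forces the signs. So \<open>X\<close> alone determines the group element.\<close>

lemma canonical_determines:
  assumes X: "X \<in> Zdk d k" and g: "g \<in> wgrp k" and can: "canonical k (wact g X)"
  shows "snd g = (\<lambda>r. if r < k then order_index k X r else r)"
    and "fst g = {i. i < k \<and> X (inv (snd g) i) (lead (X (inv (snd g) i))) < 0}"
proof -
  let ?\<tau> = "snd g"
  note \<tau> = wgrpD[OF g]
  have inv: "inv ?\<tau> (?\<tau> r) = r" for r using \<tau>(3) by (rule inv_f_f)
  have lt: "?\<tau> r < k \<longleftrightarrow> r < k" for r using permutes_in_image[OF \<tau>(2), of r] by simp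
  have less: "lexless (affine_form (X r)) (affine_form (X s))" if "?\<tau> r < ?\<tau> s" "s < k" for r s
    using can that lt unfolding canonical_def wact_row[OF g] by (metis inv)
  have less_iff: "lexless (affine_form (X r)) (affine_form (X s)) \<longleftrightarrow> ?\<tau> r < ?\<tau> s" if "r < k" "s < k" for r s
    using less[of r s] less[of s r] that lexless_irrefl lexless_trans \<tau>(3)
    by (metis injD linorder_neqE_nat)
  have "?\<tau> r = order_index k X r" if r: "r < k" for r
  proof -
    have "?\<tau> ` {s. s < k \<and> lexless (affine_form (X s)) (affine_form (X r))} = {..<?\<tau> r}"
    proof (intro equalityI subsetI)
      fix i assume i: "i \<in> {..<?\<tau> r}"
      have "?\<tau> (inv ?\<tau> i) = i" using \<tau>(4) by (rule surj_f_inv_f)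
      moreover from this have "inv ?\<tau> i < k" using i lt[of r] lt[of "inv ?\<tau> i"] r by simp
      ultimately show "i \<in> ?\<tau> ` {s. s < k \<and> lexless (affine_form (X s)) (affine_form (X r))}"
        using i less_iff r by (intro image_eqI[of _ _ "inv ?\<tau> i"]) auto
    qed (use less_iff r in auto)
    moreover have "inj_on ?\<tau> {s. s < k \<and> lexless (affine_form (X s)) (affine_form (X r))}"
      using \<tau>(3) by (rule inj_on_subset) simp
    ultimately have "card {s. s < k \<and> lexless (affine_form (X s)) (affine_form (X r))} = card {..<?\<tau> r}"
      using card_image by fastforce
    then show ?thesis by (simp add: order_index_def)
  qed
  moreover have "?\<tau> r = r" if "\<not> r < k" for r
    using \<tau>(2) that by (auto simp: permutes_def)
  ultimately show "?\<tau> = (\<lambda>r. if r < k then order_index k X r else r)" by auto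
  have pos: "0 < wact g X i (lead (X (inv ?\<tau> i)))" if "i < k" for i
    using can that by (simp add: canonical_def wact_row[OF g])
  then have "i \<in> fst g \<longleftrightarrow> X (inv ?\<tau> i) (lead (X (inv ?\<tau> i))) < 0" if "i < k" for i
    using pos[OF that] by (auto simp: wact_def actZ_def split: if_splits)
  then show "fst g = {i. i < k \<and> X (inv ?\<tau> i) (lead (X (inv ?\<tau> i))) < 0}"
    using \<tau>(1) by auto
qed

lemma canonical_unique:
  assumes "X \<in> Zdk d k" "g \<in> wgrp k" "h \<in> wgrp k" "canonical k (wact g X)" "canonical k (wact h X)"
  shows "g = h"
proof -
  have "snd g = snd h"
    using canonical_determines(1)[OF assms(1,2,4)] canonical_determines(1)[OF assms(1,3,5)] by simp
  moreover from this have "fst g = fst h"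
    using canonical_determines(2)[OF assms(1,2,4)] canonical_determines(2)[OF assms(1,3,5)] by simp
  ultimately show ?thesis by (simp add: prod_eq_iff)
qed

text \<open>The factor 2 makes the doubled larger one of two overlapping balls contain the centre of the
  other.\<close>

definition good_ball :: "nat \<Rightarrow> nat \<Rightarrow> nat \<Rightarrow> (nat \<Rightarrow> nat \<Rightarrow> real) \<Rightarrow> real \<Rightarrow> bool" where
  "good_ball d k q Y r \<longleftrightarrow> Y \<in> Zdk d k \<and> canonical k Y \<and> form_rank d k Y = q \<and> 0 < r \<and> r \<le> 1 \<and>
     (\<forall>Y'\<in>Zdk d k. l1dist d k Y Y' < 2 * r \<and> form_rank d k Y' = q \<longrightarrow> canonical k Y')"

text \<open>A supremum of cones of slope 1, positive exactly on the union of the good balls. It is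
  defined at configurations of every rank, so continuity needs no argument about how the rank
  changes. The inserted 0 is its value away from the balls.\<close>

definition bump :: "nat \<Rightarrow> nat \<Rightarrow> nat \<Rightarrow> (nat \<Rightarrow> nat \<Rightarrow> real) \<Rightarrow> real" where
  "bump d k q X = Sup (insert 0 {r - l1dist d k X Y | Y r. good_ball d k q Y r})"

lemma bdd_above_bump: "bdd_above (insert 0 {r - l1dist d k X Y | Y r. good_ball d k q Y r})"
proof (rule bdd_aboveI[of _ 1])
  fix y assume "y \<in> insert 0 {r - l1dist d k X Y | Y r. good_ball d k q Y r}"
  then consider "y = 0" | Y r where "y = r - l1dist d k X Y" "r \<le> 1" by (auto simp: good_ball_def)
  then show "y \<le> 1"
  proof cases
    case (2 Y r)
    then show ?thesis using l1dist_nonneg[of d k X Y] by linarith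
  qed simp
qed

lemma bump_nonneg: "0 \<le> bump d k q X"
  unfolding bump_def using bdd_above_bump by (intro cSup_upper) auto

lemma bump_ge: "good_ball d k q Y r \<Longrightarrow> r - l1dist d k X Y \<le> bump d k q X"
  unfolding bump_def using bdd_above_bump by (intro cSup_upper) auto

lemma bump_pos:
  assumes "bump d k q X > 0"
  obtains Y r where "good_ball d k q Y r" "l1dist d k X Y < r"
proof -
  obtain y where "y \<in> insert 0 {r - l1dist d k X Y | Y r. good_ball d k q Y r}" "0 < y"
    using assms unfolding bump_def by (subst (asm) less_cSup_iff[OF _ bdd_above_bump]) auto
  then show thesis using that by auto
qed

lemma bump_lipschitz: "bump d k q X \<le> bump d k q X' + l1dist d k X X'"
  unfolding bump_def[of d k q X]
proof (rule cSup_least)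
  fix y assume "y \<in> insert 0 {r - l1dist d k X Y | Y r. good_ball d k q Y r}"
  then consider "y = 0" | Y r where "y = r - l1dist d k X Y" "good_ball d k q Y r" by auto
  then show "y \<le> bump d k q X' + l1dist d k X X'"
  proof cases
    case 1 then show ?thesis using bump_nonneg l1dist_nonneg by (simp add: add_nonneg_nonneg)
  next
    case (2 Y r)
    then show ?thesis
      using bump_ge[OF 2(2), of X'] l1dist_triangle[of d k X' Y X] l1dist_sym[of d k X X'] by linarith
  qed
qed simp

lemma continuous_on_entry: "continuous_on S (\<lambda>X. X r i)"
  for S :: "(nat \<Rightarrow> nat \<Rightarrow> real) set"
  by (rule continuous_on_product_then_coordinatewise)
     (rule continuous_on_subset[OF continuous_on_product_coordinates], simp)

text \<open>\<open>bump\<close> is 1-Lipschitz for \<open>l1dist\<close>, which is itself continuous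
  for the product topology.\<close>

lemma continuous_bump: "continuous_on S (\<lambda>X. bump d k q (wact g X))"
proof -
  have c1: "continuous_on UNIV (wact g)"
    unfolding wact_def actZ_def
    by (intro continuous_on_coordinatewise_then_product continuous_on_mult continuous_on_entry
        continuous_on_const)
  have "isCont (bump d k q) X" for X
  proof -
    have "continuous_on UNIV (\<lambda>Y. l1dist d k Y X)"
      unfolding l1dist_def
      by (intro continuous_on_sum continuous_on_rabs continuous_on_diff continuous_on_entry continuous_on_const)
    then have "((\<lambda>Y. l1dist d k Y X) \<longlongrightarrow> l1dist d k X X) (at X)"
      unfolding continuous_on_def by (metis UNIV_I)
    then have lim: "((\<lambda>Y. l1dist d k Y X) \<longlongrightarrow> 0) (at X)" by simp
    have le: "norm (bump d k q Y - bump d k q X) \<le> l1dist d k Y X" for Y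
      using bump_lipschitz[of d k q X Y] bump_lipschitz[of d k q Y X] l1dist_sym[of d k X Y]
      unfolding real_norm_def by linarith
    have "((\<lambda>Y. bump d k q Y - bump d k q X) \<longlongrightarrow> 0) (at X)"
      by (rule Lim_null_comparison[OF always_eventually[OF allI[OF le]] lim])
    then show ?thesis by (simp add: isCont_def LIM_zero_iff)
  qed
  then have c2: "continuous_on UNIV (bump d k q)"
    by (simp add: continuous_at_imp_continuous_on)
  have "continuous_on UNIV (\<lambda>X. bump d k q (wact g X))"
    by (rule continuous_on_compose2[OF c2 c1]) simp
  then show ?thesis by (rule continuous_on_subset) simp
qed

lemma bump_exists:
  assumes X: "X \<in> Zdk d k"
  shows "\<exists>g\<in>wgrp k. bump d k (form_rank d k X) (wact g X) > 0"
proof -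
  obtain g where g: "g \<in> wgrp k" "canonical k (wact g X)"
    using canonical_exists[OF X] by blast
  have Z: "wact g X \<in> Zdk d k" using wact_in_Zdk[OF g(1) X] .
  obtain \<epsilon> where \<epsilon>: "\<epsilon> > 0" "\<forall>Y\<in>Zdk d k. l1dist d k (wact g X) Y < \<epsilon> \<and>
      form_rank d k Y = form_rank d k (wact g X) \<longrightarrow> canonical k Y"
    using canonical_near[OF Z g(2)] by blast
  \<comment> \<open>Halving \<open>\<epsilon>\<close> pays for the doubled radius in
    \<open>good_ball\<close>; the cap 1 keeps the supremum bounded.\<close>
  then have "good_ball d k (form_rank d k X) (wact g X) (min 1 (\<epsilon> / 2))"
    using g Z by (auto simp: good_ball_def form_rank_wact)
  from bump_ge[OF this, of "wact g X"] \<epsilon>(1) g(1) show ?thesis by (intro bexI[of _ g]) auto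
qed

text \<open>The rank of \<open>X\<close> may differ from \<open>q\<close>, so uniqueness is applied
  to \<open>W\<close>, the centre \<open>Y'\<close> moved back by \<open>h\<close>, which has rank
  \<open>q\<close> and lies near \<open>X\<close>. Then \<open>wact h W\<close> is the canonical
  \<open>Y'\<close>, and \<open>wact g W\<close> lies within r + r' of \<open>Y\<close>, inside the
  doubled larger ball, so it is canonical too.\<close>

lemma bump_unique_aux:
  assumes X: "X \<in> Zdk d k" and g: "g \<in> wgrp k" and h: "h \<in> wgrp k"
    and Y: "good_ball d k q Y r" "l1dist d k (wact g X) Y < r"
    and Y': "good_ball d k q Y' r'" "l1dist d k (wact h X) Y' < r'" and le: "r' \<le> r"
  shows "g = h"
proof -
  define W where "W = wact (winv h) Y'"
  have hW: "wact h W = Y'" unfolding W_def using h by (rule wact_winv)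
  have W: "W \<in> Zdk d k"
    unfolding W_def using Y' h by (intro wact_in_Zdk winv_wgrp) (auto simp: good_ball_def)
  have rW: "form_rank d k W = q"
    unfolding W_def using Y' by (simp add: form_rank_wact[OF winv_wgrp[OF h]] good_ball_def)
  have "l1dist d k X W < r'"
    using Y'(2) l1dist_wact[OF h, of d X W] by (simp add: hW)
  then have "l1dist d k (wact g X) (wact g W) < r'" by (simp add: l1dist_wact[OF g])
  then have "l1dist d k Y (wact g W) < 2 * r"
    using l1dist_triangle[of d k Y "wact g W" "wact g X"] Y(2) le l1dist_sym[of d k Y "wact g X"]
    by linarith
  then have "canonical k (wact g W)"
    using Y(1) W rW wact_in_Zdk[OF g W] by (auto simp: good_ball_def form_rank_wact[OF g])
  moreover have "canonical k (wact h W)" using Y'(1) by (simp add: hW good_ball_def)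
  ultimately show "g = h" using canonical_unique[OF W g h] by simp
qed

lemma bump_unique:
  assumes X: "X \<in> Zdk d k" and g: "g \<in> wgrp k" and h: "h \<in> wgrp k"
    and pos: "bump d k q (wact g X) > 0" "bump d k q (wact h X) > 0"
  shows "g = h"
proof -
  obtain Y r where Y: "good_ball d k q Y r" "l1dist d k (wact g X) Y < r"
    using bump_pos[OF pos(1)] .
  obtain Y' r' where Y': "good_ball d k q Y' r'" "l1dist d k (wact h X) Y' < r'"
    using bump_pos[OF pos(2)] .
  show ?thesis
  proof (cases "r' \<le> r")
    case True then show ?thesis using bump_unique_aux[OF X g h Y Y'] by simp
  next
    case False then show ?thesis using bump_unique_aux[OF X h g Y' Y] by simp
  qed
qed

subsection \<open>The equivariant map\<close>

text \<open>The coefficient of \<open>v i\<close> at \<open>windex g \<alpha>\<close> is that of its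
  translate by the inverse of g at \<alpha>, so the last clause covers all choices of translates.
  The bound on \<open>M\<close> is the dimension of the j-fold sum of U.\<close>

lemma equivariant_general_position:
  assumes M: "M \<le> (2 ^ k - 1) * j"
  shows "\<exists>v :: nat \<Rightarrow> nat \<Rightarrow> nat set \<Rightarrow> real.
    (\<forall>i l \<alpha>. \<not> (l < j \<and> \<alpha> \<subseteq> {..<k}) \<longrightarrow> v i l \<alpha> = 0) \<and>
    (\<forall>i l. (\<Sum>\<alpha>\<in>Pow {..<k}. v i l \<alpha>) = 0) \<and>
    (\<forall>\<gamma> c. (\<forall>i<M. \<gamma> i \<in> wgrp k) \<longrightarrow>
      (\<forall>l<j. \<forall>\<alpha>\<in>Pow {..<k}. (\<Sum>i<M. c i * v i l (windex (\<gamma> i) \<alpha>)) = 0) \<longrightarrow>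
      (\<forall>i<M. c i = 0))"
proof -
  define I where "I = {..<j} \<times> Pow {..<k}"
  have I: "finite I" "card I = j * 2 ^ k" by (simp_all add: I_def card_cartesian_product card_Pow)
  obtain e :: "nat \<times> nat set \<Rightarrow> nat" where e: "inj_on e I"
    using finite_imp_inj_to_nat_seg[OF I(1)] by blast
  define mean where "mean t l = (\<Sum>\<alpha>\<in>Pow {..<k}. t ^ e (l, \<alpha>)) / 2 ^ k" for t :: real and l
  \<comment> \<open>The moment curve with distinct exponents, projected to U in each summand by
    subtracting the mean.\<close>
  define u where "u t l \<alpha> = (if l < j \<and> \<alpha> \<subseteq> {..<k} then t ^ e (l, \<alpha>) - mean t l else 0)" for t l \<alpha>
  \<comment> \<open>Functionals with zero sum on each summand do not see the subtracted means, so
    their values on the curve are genuine sums of distinct powers.\<close>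
  define A :: "(nat \<times> nat set \<Rightarrow> real) set" where
    "A = {a. (\<forall>l<j. (\<Sum>\<alpha>\<in>Pow {..<k}. a (l, \<alpha>)) = 0) \<and> (\<exists>x\<in>I. a x \<noteq> 0)}"
  define w where "w g t x = u t (fst x) (windex g (snd x))" for g t x
  have fin: "finite {t. (\<Sum>x\<in>I. a x * w g t x) = 0}" if a: "a \<in> A" and g: "g \<in> wgrp k" for a g
  proof -
    define e' where "e' x = e (fst x, windex g (snd x))" for x
    have win: "windex g \<alpha> \<in> Pow {..<k}" if "\<alpha> \<in> Pow {..<k}" for \<alpha>
      using windex_subset_iff[OF g] that by simp
    have inj: "inj_on e' I"
    proof (rule inj_onI)
      fix x y assume xy: "x \<in> I" "y \<in> I" "e' x = e' y"
      then have "(fst x, windex g (snd x)) = (fst y, windex g (snd y))"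
        using win by (intro inj_onD[OF e]) (simp_all add: I_def e'_def mem_Times_iff)
      then show "x = y"
        using xy inj_onD[OF bij_betw_imp_inj_on[OF bij_windex[OF g]], of "snd x" "snd y"]
        by (auto simp: I_def)
    qed
    have "(\<Sum>x\<in>I. a x * w g t x) = (\<Sum>x\<in>I. a x * t ^ e' x)" for t
    proof -
      have "(\<Sum>x\<in>I. a x * w g t x) = (\<Sum>x\<in>I. a x * t ^ e' x - a x * mean t (fst x))"
        using win
        by (intro sum.cong) (simp_all add: w_def u_def e'_def I_def mem_Times_iff right_diff_distrib)
      also have "\<dots> = (\<Sum>x\<in>I. a x * t ^ e' x) - (\<Sum>x\<in>I. a x * mean t (fst x))"
        by (rule sum_subtractf)
      also have "(\<Sum>x\<in>I. a x * mean t (fst x)) = (\<Sum>l<j. \<Sum>\<alpha>\<in>Pow {..<k}. a (l, \<alpha>) * mean t l)"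
        unfolding I_def by (simp add: sum.cartesian_product case_prod_beta)
      also have "\<dots> = (\<Sum>l<j. (\<Sum>\<alpha>\<in>Pow {..<k}. a (l, \<alpha>)) * mean t l)"
        by (simp add: sum_distrib_right)
      also have "\<dots> = 0" using a by (intro sum.neutral) (auto simp: A_def)
      finally show ?thesis by simp
    qed
    moreover obtain x where "x \<in> I" "a x \<noteq> 0" using a by (auto simp: A_def)
    ultimately show ?thesis
      using finite_zeros_exponential_sum[OF I(1) inj] by simp
  qed
  have ann: "\<exists>a\<in>A. \<forall>i<n. (\<Sum>x\<in>I. a x * W i x) = 0" if "n < M" for n W
  proof -
    have "(2 ^ k - 1) * j + j = (2 ^ k - 1 + 1) * j" by (simp only: distrib_right mult_1)
    then have "(2 ^ k - 1) * j + j = j * 2 ^ k" by simp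
    \<comment> \<open>There are \<open>n\<close> orthogonality conditions and \<open>j\<close>
      zero-sum conditions, one per summand, on \<open>j * 2 ^ k\<close> unknowns; the equations from
      \<open>n\<close> on encode the latter.\<close>
    with M that have "n + j < card I" unfolding I(2) by linarith
    then obtain a where a: "\<exists>x\<in>I. a x \<noteq> 0" and
      z: "\<And>i. i < n + j \<Longrightarrow> (\<Sum>x\<in>I. a x * (if i < n then W i x else if fst x = i - n then 1 else 0)) = 0"
      using underdetermined_system_solution[OF I(1), of "n + j"
          "\<lambda>i x. if i < n then W i x else if fst x = i - n then 1 else 0"] by blast
    have "(\<Sum>\<alpha>\<in>Pow {..<k}. a (l, \<alpha>)) = 0" if l: "l < j" for l
    proof -
      have "(\<Sum>x\<in>I. a x * (if fst x = l then 1 else 0)) = 0" using z[of "n + l"] l by simp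
      moreover have "(\<Sum>x\<in>I. a x * (if fst x = l then 1 else 0))
          = (\<Sum>l'<j. \<Sum>\<alpha>\<in>Pow {..<k}. a (l', \<alpha>) * (if l' = l then 1 else 0))"
        unfolding I_def by (simp add: sum.cartesian_product case_prod_beta)
      moreover have "\<dots> = (\<Sum>l'<j. if l' = l then \<Sum>\<alpha>\<in>Pow {..<k}. a (l', \<alpha>) else 0)"
        by (intro sum.cong) auto
      ultimately show ?thesis using l by simp
    qed
    moreover have "(\<Sum>x\<in>I. a x * W i x) = 0" if "i < n" for i using z[of i] that by simp
    ultimately show ?thesis using a by (auto simp: A_def)
  qed
  have "\<exists>T. \<forall>\<gamma> c. (\<forall>i<M. \<gamma> i \<in> wgrp k) \<longrightarrow>
      (\<forall>x\<in>I. (\<Sum>i<M. c i * w (\<gamma> i) (T i) x) = 0) \<longrightarrow> (\<forall>i<M. c i = (0::real))"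
  proof (rule translates_in_general_position[where A = A])
    show "finite (wgrp k)" by (rule finite_wgrp)
  qed (fact fin ann)+
  then obtain T where T: "\<forall>\<gamma> c. (\<forall>i<M. \<gamma> i \<in> wgrp k) \<longrightarrow>
      (\<forall>x\<in>I. (\<Sum>i<M. c i * w (\<gamma> i) (T i) x) = 0) \<longrightarrow> (\<forall>i<M. c i = (0::real))" ..
  show ?thesis
  proof (intro exI[of _ "\<lambda>i. u (T i)"] conjI allI impI)
    show "u (T i) l \<alpha> = 0" if "\<not> (l < j \<and> \<alpha> \<subseteq> {..<k})" for i l \<alpha>
      unfolding u_def using that by (rule if_not_P)
    show "(\<Sum>\<alpha>\<in>Pow {..<k}. u (T i) l \<alpha>) = 0" for i l
    proof (cases "l < j")
      case True
      then have "(\<Sum>\<alpha>\<in>Pow {..<k}. u (T i) l \<alpha>) = (\<Sum>\<alpha>\<in>Pow {..<k}. T i ^ e (l, \<alpha>) - mean (T i) l)"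
        by (intro sum.cong) (auto simp: u_def)
      then show ?thesis by (simp add: sum_subtractf mean_def card_Pow)
    qed (simp add: u_def)
    fix \<gamma> :: "nat \<Rightarrow> nat set \<times> (nat \<Rightarrow> nat)" and c :: "nat \<Rightarrow> real" and i
    assume "\<forall>i<M. \<gamma> i \<in> wgrp k" "i < M"
      and "\<forall>l<j. \<forall>\<alpha>\<in>Pow {..<k}. (\<Sum>i<M. c i * u (T i) l (windex (\<gamma> i) \<alpha>)) = 0"
    moreover from this have "\<forall>x\<in>I. (\<Sum>i<M. c i * w (\<gamma> i) (T i) x) = 0"
      by (simp add: I_def w_def)
    ultimately show "c i = 0" using T by blast
  qed
qed

section \<open>Assembling and normalising the equivariant map\<close>

theorem theorem6p1:
  fixes d k j :: nat
  assumes "3 \<le> k" and "k \<le> d" and "1 \<le> j"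
    and "(2^k - 1) * j + 2 \<ge> max (d * k) (d * k + 4 - k)"
  shows "\<exists>f :: (nat \<Rightarrow> nat \<Rightarrow> real) \<Rightarrow> (nat \<Rightarrow> nat set \<Rightarrow> real).
           continuous_on (Zdk d k) f \<and> f ` Zdk d k \<subseteq> SU k j \<and>
           (\<forall>\<beta> \<tau> X. \<beta> \<subseteq> {..<k} \<longrightarrow> \<tau> permutes {..<k} \<longrightarrow> X \<in> Zdk d k \<longrightarrow>
              f (actZ \<beta> \<tau> X) = actU \<beta> \<tau> (f X))"
proof -
  \<comment> \<open>The number of integers from k - 1 to d k; index \<open>i\<close> will stand for
    rank k - 1 + i.\<close>
  define M where "M = d * k + 2 - k"
  have "k \<le> d * k" using assms(1,2) by simp
  then have "d * k + 4 - k = M + 2" unfolding M_def by linarith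
  then have M: "M \<le> (2 ^ k - 1) * j" using assms(4) by linarith
  obtain v :: "nat \<Rightarrow> nat \<Rightarrow> nat set \<Rightarrow> real" where
    v: "\<forall>i l \<alpha>. \<not> (l < j \<and> \<alpha> \<subseteq> {..<k}) \<longrightarrow> v i l \<alpha> = 0"
      "\<forall>i l. (\<Sum>\<alpha>\<in>Pow {..<k}. v i l \<alpha>) = 0"
      "\<forall>\<gamma> c. (\<forall>i<M. \<gamma> i \<in> wgrp k) \<longrightarrow>
        (\<forall>l<j. \<forall>\<alpha>\<in>Pow {..<k}. (\<Sum>i<M. c i * v i l (windex (\<gamma> i) \<alpha>)) = 0) \<longrightarrow>
        (\<forall>i<M. c i = 0)"
    using equivariant_general_position[OF M] by (elim exE conjE) (rule that)
  note v0 = v(1)[rule_format] and vsum = v(2)[rule_format]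
  define b where "b i g X = bump d k (k - 1 + i) (wact g X)" for i g X
  \<comment> \<open>Averaging over the group: \<open>v i l (windex g \<alpha>)\<close> is the
    coordinate at \<alpha> of the translate of \<open>v i\<close> by the inverse of g.\<close>
  define F where "F X l \<alpha> = (\<Sum>i<M. \<Sum>g\<in>wgrp k. b i g X * v i l (windex g \<alpha>))" for X l \<alpha>
  define N where "N X = (\<Sum>l<j. \<Sum>\<alpha>\<in>Pow {..<k}. (F X l \<alpha>)\<^sup>2)" for X
  define f where "f X = (\<lambda>l \<alpha>. F X l \<alpha> / sqrt (N X))" for X
  have F0: "F X l \<alpha> = 0" if "\<not> (l < j \<and> \<alpha> \<subseteq> {..<k})" for X l \<alpha>
    unfolding F_def using that v0 windex_subset_iff by (intro sum.neutral ballI) auto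
  have Fsum: "(\<Sum>\<alpha>\<in>Pow {..<k}. F X l \<alpha>) = 0" for X l
  proof -
    have "(\<Sum>\<alpha>\<in>Pow {..<k}. F X l \<alpha>)
        = (\<Sum>i<M. \<Sum>g\<in>wgrp k. \<Sum>\<alpha>\<in>Pow {..<k}. b i g X * v i l (windex g \<alpha>))"
      unfolding F_def by (subst sum.swap) (intro sum.cong refl sum.swap)
    also have "\<dots> = (\<Sum>i<M. \<Sum>g\<in>wgrp k. b i g X * (\<Sum>\<alpha>\<in>Pow {..<k}. v i l \<alpha>))"
      unfolding sum_distrib_left[symmetric]
      by (intro sum.cong refl arg_cong2[of _ _ _ _ "(*)"] sum.reindex_bij_betw bij_windex)
    finally show ?thesis by (simp add: vsum)
  qed
  have Fact: "F (wact h X) l (windex h \<alpha>) = F X l \<alpha>" if h: "h \<in> wgrp k" for h X l \<alpha>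
  proof -
    have "F (wact h X) l (windex h \<alpha>)
        = (\<Sum>i<M. \<Sum>g\<in>wgrp k. b i (wmul g h) X * v i l (windex (wmul g h) \<alpha>))"
      unfolding F_def b_def using h by (intro sum.cong refl) (simp add: wact_wmul windex_wmul)
    also have "\<dots> = F X l \<alpha>"
      unfolding F_def by (intro sum.cong refl sum.reindex_bij_betw[OF bij_wmul[OF h]])
    finally show ?thesis .
  qed
  have Nact: "N (wact h X) = N X" if h: "h \<in> wgrp k" for h X
  proof -
    have "(\<Sum>\<alpha>\<in>Pow {..<k}. (F (wact h X) l \<alpha>)\<^sup>2) = (\<Sum>\<alpha>\<in>Pow {..<k}. (F X l \<alpha>)\<^sup>2)" for l
      using sum.reindex_bij_betw[OF bij_windex[OF h], of "\<lambda>\<alpha>. (F (wact h X) l \<alpha>)\<^sup>2"]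
      by (simp add: Fact[OF h])
    then show ?thesis by (simp add: N_def)
  qed
  have Npos: "N X > 0" if X: "X \<in> Zdk d k" for X
  proof (rule ccontr)
    assume "\<not> N X > 0"
    moreover have nn: "0 \<le> (\<Sum>\<alpha>\<in>Pow {..<k}. (F X l \<alpha>)\<^sup>2)" for l by (simp add: sum_nonneg)
    then have "N X \<ge> 0" unfolding N_def by (intro sum_nonneg zero_le_power2)
    ultimately have "N X = 0" by simp
    then have Fz: "F X l \<alpha> = 0" if "l < j" "\<alpha> \<subseteq> {..<k}" for l \<alpha>
      using that nn unfolding N_def by (simp add: sum_nonneg_eq_0_iff)
    \<comment> \<open>For each \<open>i\<close> at most one group element is active; if none is, any
      element serves.\<close>
    have "\<exists>g\<in>wgrp k. \<forall>h\<in>wgrp k. h \<noteq> g \<longrightarrow> b i h X = 0" for i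
    proof (cases "\<exists>g\<in>wgrp k. b i g X > 0")
      case True
      then obtain g where g: "g \<in> wgrp k" "b i g X > 0" by blast
      have "b i h X = 0" if "h \<in> wgrp k" "h \<noteq> g" for h
        using bump_unique[OF X that(1) g(1), of "k - 1 + i"] g(2) that(2)
          bump_nonneg[of d k "k - 1 + i" "wact h X"] by (force simp: b_def)
      with g(1) show ?thesis by blast
    next
      case False
      moreover have "({}, id) \<in> wgrp k" by (simp add: wgrp_def permutes_id)
      ultimately show ?thesis
        using bump_nonneg by (metis b_def less_eq_real_def)
    qed
    then obtain \<gamma> where \<gamma>: "\<And>i. \<gamma> i \<in> wgrp k" "\<And>i h. h \<in> wgrp k \<Longrightarrow> h \<noteq> \<gamma> i \<Longrightarrow> b i h X = 0"
      by metis
    have "F X l \<alpha> = (\<Sum>i<M. b i (\<gamma> i) X * v i l (windex (\<gamma> i) \<alpha>))" for l \<alpha>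
    proof -
      have "(\<Sum>g\<in>wgrp k. b i g X * v i l (windex g \<alpha>)) = b i (\<gamma> i) X * v i l (windex (\<gamma> i) \<alpha>)" for i
        using sum.remove[OF finite_wgrp \<gamma>(1)[of i], of "\<lambda>g. b i g X * v i l (windex g \<alpha>)"] \<gamma>(2)
        by simp
      then show ?thesis by (simp add: F_def)
    qed
    \<comment> \<open>With one translate per index left, a zero of \<open>F\<close> is a linear
      relation between independent vectors, so all bumps would vanish at \<open>X\<close>. The index
      belonging to the rank of \<open>X\<close> refutes this.\<close>
    then have bz: "\<forall>i<M. b i (\<gamma> i) X = 0"
      using Fz \<gamma>(1) v(3)[THEN spec[of _ \<gamma>], THEN spec[of _ "\<lambda>i. b i (\<gamma> i) X"]] by simp
    define i where "i = form_rank d k X - (k - 1)"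
    have "k - 1 \<le> form_rank d k X" using form_rank_ge[OF X] assms(1,2) by simp
    then have i: "k - 1 + i = form_rank d k X" by (simp add: i_def)
    have "i < M" using i form_rank_le[of d k X] assms(1) by (simp add: M_def)
    obtain g where g: "g \<in> wgrp k" "b i g X > 0"
      using bump_exists[OF X] unfolding b_def i by blast
    then have "g = \<gamma> i" using \<gamma>(2)[of g i] by auto
    with g bz \<open>i < M\<close> show False by simp
  qed
  have cF: "continuous_on (Zdk d k) (\<lambda>X. F X l \<alpha>)" for l \<alpha>
    unfolding F_def b_def
    by (intro continuous_on_sum continuous_on_mult continuous_bump continuous_on_const)
  have cN: "continuous_on (Zdk d k) N"
    unfolding N_def by (intro continuous_on_sum continuous_on_power cF)
  have "continuous_on (Zdk d k) f"
    unfolding f_def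
  proof (intro continuous_on_coordinatewise_then_product)
    show "continuous_on (Zdk d k) (\<lambda>X. F X l \<alpha> / sqrt (N X))" for l \<alpha>
      using Npos by (intro continuous_on_divide cF continuous_on_real_sqrt cN) force
  qed
  moreover have "f X \<in> SU k j" if X: "X \<in> Zdk d k" for X
  proof -
    have "(\<Sum>l<j. \<Sum>\<alpha>\<in>Pow {..<k}. (f X l \<alpha>)\<^sup>2)
        = (\<Sum>l<j. \<Sum>\<alpha>\<in>Pow {..<k}. (F X l \<alpha>)\<^sup>2 / N X)"
      using Npos[OF X] by (simp add: f_def power_divide)
    also have "\<dots> = N X / N X"
      unfolding sum_divide_distrib[symmetric] by (simp only: N_def)
    also have "\<dots> = 1" using Npos[OF X] by simp
    finally have norm: "(\<Sum>l<j. \<Sum>\<alpha>\<in>Pow {..<k}. (f X l \<alpha>)\<^sup>2) = 1" .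
    have zero: "f X l \<alpha> = 0" if "\<not> (l < j \<and> \<alpha> \<subseteq> {..<k})" for l \<alpha>
      using F0[OF that] by (simp add: f_def)
    have "(\<Sum>\<alpha>\<in>Pow {..<k}. f X l \<alpha>) = 0" for l
      by (simp add: f_def sum_divide_distrib[symmetric] Fsum)
    with norm zero show ?thesis unfolding SU_def by blast
  qed
  moreover have "f (actZ \<beta> \<tau> X) = actU \<beta> \<tau> (f X)"
    if "\<beta> \<subseteq> {..<k}" "\<tau> permutes {..<k}" for \<beta> \<tau> X
  proof -
    let ?h = "(\<beta>, \<tau>)"
    have h: "?h \<in> wgrp k" using that by (simp add: wgrp_def)
    have "f (wact ?h X) l \<alpha> = actU \<beta> \<tau> (f X) l \<alpha>" for l \<alpha>
    proof -
      obtain \<alpha>' where "\<alpha> = windex ?h \<alpha>'" using surj_windex[OF h] by blast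
      then show ?thesis
        using actU_windex[OF h, of "f X" l \<alpha>'] by (simp add: f_def Fact[OF h] Nact[OF h])
    qed
    then show ?thesis by (simp add: wact_def fun_eq_iff)
  qed
  ultimately show ?thesis by (intro exI[of _ f]) auto
qed

end
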